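(* Let $\mathcal{M}=(G;\Omega,\rho,\tau)$ be an algebraic map and let $\alpha\in\Omega$, with stabilizer $G_\alpha$ in $G$. Then the underlying graph $\Sigma$ of $\mathcal{M}$ is isomorphic to the monodromy graph $\mathrm{Mon}(G;G_\alpha,\rho,\tau)$.
   Context: An algebraic map $(G;\Omega,\rho,\tau)$ consists of a finite set $\Omega$ (of darts) and permutations $\rho,\tau$ of $\Omega$ with $\tau^2=1$ such that $G=\langle\rho,\tau\rangle\le\mathrm{Sym}(\Omega)$ acts transitively on $\Omega$ (so $G_\alpha$ is core-free in $G$). Its underlying graph $\Sigma$ has as vertices the cycles (orbits) of $\rho$ on $\Omega$ and as edges the cycles of $\tau$ on $\Omega$; a $\tau$-cycle $\{\beta,\beta^\tau\}$ with $\beta\ne\beta^\tau$ is an edge joining the vertices containing $\beta$ and $\beta^\tau$ (a loop if these coincide), and a fixed point $\beta=\beta^\tau$ is a free edge (an edge with only one end, at the vertex containing $\beta$). Graphs may have loops, multiple edges and free edges. Monodromy graph: for $G=\langle\rho,\tau\rangle$ with $\tau^2=1$, $U$ a core-free subgroup (i.e. $\bigcap_{g}g^{-1}Ug=1$), $H=\langle\rho\rangle$, and $S$ a right transversal of $U$ in $G$, $\mathrm{Mon}(G;U,\rho,\tau)$ has vertex set $\{UgH\mid g\in G\}$, edge set $\{\{UhH,Uh\tau H\}\mid h\in S\}$, and for $h\in S$ the multiplicity of the edge between $UhH$ and $Uh\tau H$ is $|D|$ where $D=\{g\in S\mid g\in UhH \text{ and } g\tau\in Uh\tau H\}$; the edge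 is a free edge if $h\tau\in Uh$ and a loop if $h\tau\notin Uh$ but $h\tau\in UhH$.
   Formalization: The multiplicity |D| is kept for edges joining distinct vertices; when UhH = UhτH, free edges are counted by the g in D with gτ in Ug, and loops by half the number of g in D with gτ not in Ug, since the literal |D| counts each loop twice and mixes in free edges. *)

theory Defs
  imports
    "HOL-Algebra.Generated_Groups"
    "HOL-Combinatorics.Orbits"
    "HOL-Library.Multiset"
begin

section \<open>Graphs with loops, multiple edges and free edges\<close>

text \<open>
  The ends of an edge form a multiset: a link has two distinct ends \<open>{#u, v#}\<close>, a loop has the
  same end twice, \<open>{#v, v#}\<close>, and a free edge has a single end, \<open>{#v#}\<close>.
\<close>

record ('v, 'e) graph =
  verts :: "'v set"
  edges :: "'e set"
  ends :: "'e \<Rightarrow> 'v multiset"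

definition wf_graph :: "('v, 'e) graph \<Rightarrow> bool" where
  "wf_graph \<Gamma> \<longleftrightarrow>
     (\<forall>e \<in> edges \<Gamma>. set_mset (ends \<Gamma> e) \<subseteq> verts \<Gamma> \<and> size (ends \<Gamma> e) \<in> {1, 2})"

definition graph_isomorphic :: "('v, 'e) graph \<Rightarrow> ('w, 'f) graph \<Rightarrow> bool" where
  "graph_isomorphic \<Gamma> \<Delta> \<longleftrightarrow>
     (\<exists>\<phi> \<psi>. bij_betw \<phi> (verts \<Gamma>) (verts \<Delta>) \<and> bij_betw \<psi> (edges \<Gamma>) (edges \<Delta>) \<and>
        (\<forall>e \<in> edges \<Gamma>. ends \<Delta> (\<psi> e) = image_mset \<phi> (ends \<Gamma> e)))"


section \<open>Algebraic maps\<close>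

text \<open>
  Permutations act on the right, so the product \<open>p \<otimes> q\<close> is \<open>p\<close> followed by \<open>q\<close>.
\<close>

definition Sym :: "'a set \<Rightarrow> ('a \<Rightarrow> 'a) monoid" where
  "Sym \<Omega> = \<lparr>carrier = {p. p permutes \<Omega>}, monoid.mult = (\<lambda>p q. q \<circ> p), one = id\<rparr>"

locale algebraic_map =
  fixes G :: "('a \<Rightarrow> 'a) monoid" and \<Omega> :: "'a set" and \<rho> \<tau> :: "'a \<Rightarrow> 'a"
  assumes finite_darts: "finite \<Omega>"
    and rho_permutes: "\<rho> permutes \<Omega>"
    and tau_permutes: "\<tau> permutes \<Omega>"
    and tau_square: "\<tau> \<circ> \<tau> = id"
    and G_generated: "G = (Sym \<Omega>)\<lparr>carrier := generate (Sym \<Omega>) {\<rho>, \<tau>}\<rparr>"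
    and transitive: "\<forall>\<beta> \<in> \<Omega>. \<forall>\<gamma> \<in> \<Omega>. \<exists>g \<in> carrier G. g \<beta> = \<gamma>"

definition point_stabilizer :: "('a \<Rightarrow> 'a) monoid \<Rightarrow> 'a \<Rightarrow> ('a \<Rightarrow> 'a) set" where
  "point_stabilizer G \<alpha> = {g \<in> carrier G. g \<alpha> = \<alpha>}"

definition underlying_graph ::
  "'a set \<Rightarrow> ('a \<Rightarrow> 'a) \<Rightarrow> ('a \<Rightarrow> 'a) \<Rightarrow> ('a set, 'a set) graph" where
  "underlying_graph \<Omega> \<rho> \<tau> =
     \<lparr>verts = orbit \<rho> ` \<Omega>, edges = orbit \<tau> ` \<Omega>,
      ends = (\<lambda>c. image_mset (orbit \<rho>) (mset_set c))\<rparr>"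


section \<open>Monodromy graphs\<close>

definition core_free :: "('g, 'm) monoid_scheme \<Rightarrow> 'g set \<Rightarrow> bool" where
  "core_free G U \<longleftrightarrow>
     (\<Inter>g \<in> carrier G. (inv\<^bsub>G\<^esub> g) <#\<^bsub>G\<^esub> U #>\<^bsub>G\<^esub> g) = {\<one>\<^bsub>G\<^esub>}"

definition right_transversal :: "('g, 'm) monoid_scheme \<Rightarrow> 'g set \<Rightarrow> 'g set \<Rightarrow> bool" where
  "right_transversal G U S \<longleftrightarrow> S \<subseteq> carrier G \<and> (\<forall>C \<in> rcosets\<^bsub>G\<^esub> U. \<exists>!s. s \<in> S \<inter> C)"

text \<open>The standing hypotheses for a monodromy graph.\<close>

locale monodromy_data = group G for G (structure) +
  fixes U :: "'a set" and \<rho> \<tau> :: 'a and S :: "'a set"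
  assumes generators: "\<rho> \<in> carrier G" "\<tau> \<in> carrier G" "carrier G = generate G {\<rho>, \<tau>}"
    and involution: "\<tau> \<otimes> \<tau> = \<one>"
    and subgroup: "subgroup U G"
    and core_free: "core_free G U"
    and transversal: "right_transversal G U S"

text \<open>The double coset \<open>U g H\<close>, where \<open>H\<close> is generated by \<open>\<rho>\<close>.\<close>

definition dcoset :: "('g, 'm) monoid_scheme \<Rightarrow> 'g set \<Rightarrow> 'g \<Rightarrow> 'g \<Rightarrow> 'g set" where
  "dcoset G U \<rho> g = (U #>\<^bsub>G\<^esub> g) <#>\<^bsub>G\<^esub> generate G {\<rho>}"

definition mon_D ::
  "('g, 'm) monoid_scheme \<Rightarrow> 'g set \<Rightarrow> 'g \<Rightarrow> 'g \<Rightarrow> 'g set \<Rightarrow> 'g \<Rightarrow> 'g set" where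
  "mon_D G U \<rho> \<tau> S h =
     {g \<in> S. g \<in> dcoset G U \<rho> h \<and> g \<otimes>\<^bsub>G\<^esub> \<tau> \<in> dcoset G U \<rho> (h \<otimes>\<^bsub>G\<^esub> \<tau>)}"

definition mon_ends ::
  "('g, 'm) monoid_scheme \<Rightarrow> 'g set \<Rightarrow> 'g \<Rightarrow> 'g \<Rightarrow> 'g \<Rightarrow> 'g set multiset" where
  "mon_ends G U \<rho> \<tau> h =
     (if h \<otimes>\<^bsub>G\<^esub> \<tau> \<in> U #>\<^bsub>G\<^esub> h then {#dcoset G U \<rho> h#}
      else {#dcoset G U \<rho> h, dcoset G U \<rho> (h \<otimes>\<^bsub>G\<^esub> \<tau>)#})"

text \<open>
  For a link, \<open>card D\<close> is the number of parallel edges. When the two double cosets coincide,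
  \<open>D\<close> contains the representatives of both the free edges and the loops at that vertex. A free
  edge is represented by one element of \<open>D\<close>, but a loop by two, namely \<open>g\<close> and the
  representative of \<open>U g \<tau>\<close>. So \<open>card D\<close> is a multiplicity in the sense of the adjacency matrix
  (a loop counts twice), and the numbers of free edges and of loops are read off from the two
  parts of \<open>D\<close>.
\<close>

definition mon_mult ::
  "('g, 'm) monoid_scheme \<Rightarrow> 'g set \<Rightarrow> 'g \<Rightarrow> 'g \<Rightarrow> 'g set \<Rightarrow> 'g \<Rightarrow> nat" where
  "mon_mult G U \<rho> \<tau> S h =
     (let D = mon_D G U \<rho> \<tau> S h in
      if h \<otimes>\<^bsub>G\<^esub> \<tau> \<in> U #>\<^bsub>G\<^esub> h then card {g \<in> D. g \<otimes>\<^bsub>G\<^esub> \<tau> \<in> U #>\<^bsub>G\<^esub> g}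
      else if h \<otimes>\<^bsub>G\<^esub> \<tau> \<in> dcoset G U \<rho> h then card {g \<in> D. g \<otimes>\<^bsub>G\<^esub> \<tau> \<notin> U #>\<^bsub>G\<^esub> g} div 2
      else card D)"

text \<open>
  Parallel edges are told apart by an index below the multiplicity; elements \<open>h\<close> of the
  transversal with equal ends contribute the same edges.
\<close>

definition Mon ::
  "('g, 'm) monoid_scheme \<Rightarrow> 'g set \<Rightarrow> 'g \<Rightarrow> 'g \<Rightarrow> 'g set
     \<Rightarrow> ('g set, 'g set multiset \<times> nat) graph" where
  "Mon G U \<rho> \<tau> S =
     \<lparr>verts = dcoset G U \<rho> ` carrier G,
      edges = {(mon_ends G U \<rho> \<tau> h, i) |h i. h \<in> S \<and> i < mon_mult G U \<rho> \<tau> S h},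
      ends = fst\<rparr>"


section \<open>Basic properties\<close>

lemma (in monodromy_data) wf_Mon: "wf_graph (Mon G U \<rho> \<tau> S)"
  using transversal generators(2)
  by (auto simp: wf_graph_def Mon_def mon_ends_def right_transversal_def subset_iff split: if_splits)

lemma (in monodromy_data) ends_Mon:
  assumes "h \<in> S"
  shows "set_mset (mon_ends G U \<rho> \<tau> h) = {dcoset G U \<rho> h, dcoset G U \<rho> (h \<otimes> \<tau>)}"
proof -
  have h: "h \<in> carrier G"
    using assms transversal by (auto simp: right_transversal_def)
  have "U #> h = U #> (h \<otimes> \<tau>)" if "h \<otimes> \<tau> \<in> U #> h"
    using repr_independence[OF that h subgroup] .
  then show ?thesis
    by (auto simp: mon_ends_def dcoset_def)
qed

lemma group_Sym: "group (Sym \<Omega>)"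
proof (rule groupI)
  fix p assume "p \<in> carrier (Sym \<Omega>)"
  then show "\<exists>q\<in>carrier (Sym \<Omega>). q \<otimes>\<^bsub>Sym \<Omega>\<^esub> p = \<one>\<^bsub>Sym \<Omega>\<^esub>"
    by (auto simp: Sym_def intro!: exI[of _ "Hilbert_Choice.inv p"] permutes_inv permutes_inv_o)
qed (auto simp: Sym_def permutes_compose permutes_id comp_assoc)

context algebraic_map
begin

lemma card_tau_cycle:
  "finite (orbit \<tau> \<beta>) \<and> card (orbit \<tau> \<beta>) \<in> {1, 2}"
proof -
  have tau_tau: "\<tau> (\<tau> x) = x" for x
    using tau_square by (simp add: fun_eq_iff)
  have "y \<in> {\<beta>, \<tau> \<beta>}" if "y \<in> orbit \<tau> \<beta>" for y
    using that by induction (auto simp: tau_tau)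
  then have "orbit \<tau> \<beta> \<subseteq> {\<beta>, \<tau> \<beta>}"
    by blast
  moreover have "orbit \<tau> \<beta> \<noteq> {}"
    using orbit.base by fast
  ultimately have "orbit \<tau> \<beta> \<in> {{\<beta>}, {\<tau> \<beta>}, {\<beta>, \<tau> \<beta>}}"
    by blast
  then show ?thesis
    using card_2_iff[of "{\<beta>, \<tau> \<beta>}"] by (elim insertE emptyE) fastforce+
qed

lemma wf_underlying_graph: "wf_graph (underlying_graph \<Omega> \<rho> \<tau>)"
proof -
  have "orbit \<tau> \<beta> \<subseteq> \<Omega>" if "\<beta> \<in> \<Omega>" for \<beta>
    using permutes_orbit_subset[OF tau_permutes that] .
  then show ?thesis
    using card_tau_cycle by (auto simp: wf_graph_def underlying_graph_def)
qed

lemma gens_in_Sym: "{\<rho>, \<tau>} \<subseteq> carrier (Sym \<Omega>)"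
  using rho_permutes tau_permutes by (simp add: Sym_def)

lemma subgroup_G: "subgroup (carrier G) (Sym \<Omega>)"
  using group.generate_is_subgroup[OF group_Sym gens_in_Sym] by (simp add: G_generated)

lemma group_G: "group G"
  using group.subgroup_imp_group[OF group_Sym subgroup_G] by (simp add: G_generated)

lemma mult_G [simp]: "p \<otimes>\<^bsub>G\<^esub> q = q \<circ> p"
  and one_G [simp]: "\<one>\<^bsub>G\<^esub> = id"
  by (simp_all add: G_generated Sym_def)

lemma G_permutes: "g \<in> carrier G \<Longrightarrow> g permutes \<Omega>"
  using subgroup.subset[OF subgroup_G] by (auto simp: Sym_def)

lemma inv_G_apply: "g \<in> carrier G \<Longrightarrow> (inv\<^bsub>G\<^esub> g) (g x) = x"
  using group.r_inv[OF group_G, of g] by (simp add: fun_eq_iff)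

lemma subgroup_point_stabilizer: "subgroup (point_stabilizer G \<alpha>) G"
proof (rule group.subgroupI[OF group_G])
  show "point_stabilizer G \<alpha> \<noteq> {}"
    using group.is_monoid[OF group_G] monoid.one_closed[of G]
    by (auto simp: point_stabilizer_def)
  fix g assume g: "g \<in> point_stabilizer G \<alpha>"
  then show "inv\<^bsub>G\<^esub> g \<in> point_stabilizer G \<alpha>"
    using inv_G_apply[of g \<alpha>] group.inv_closed[OF group_G, of g]
    by (auto simp: point_stabilizer_def)
  fix h assume "h \<in> point_stabilizer G \<alpha>"
  with g show "g \<otimes>\<^bsub>G\<^esub> h \<in> point_stabilizer G \<alpha>"
    using monoid.m_closed[OF group.is_monoid[OF group_G], of g h]
    by (auto simp: point_stabilizer_def)
qed (auto simp: point_stabilizer_def)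

lemma core_free_point_stabilizer:
  assumes "\<alpha> \<in> \<Omega>"
  shows "core_free G (point_stabilizer G \<alpha>)"
proof -
  have "x = id" if x: "\<forall>g \<in> carrier G. x \<in> (inv\<^bsub>G\<^esub> g) <#\<^bsub>G\<^esub> point_stabilizer G \<alpha> #>\<^bsub>G\<^esub> g" for x
  proof -
    have one: "id \<in> carrier G"
      using monoid.one_closed[OF group.is_monoid[OF group_G]] by simp
    with x have "x \<in> (inv\<^bsub>G\<^esub> id) <#\<^bsub>G\<^esub> point_stabilizer G \<alpha> #>\<^bsub>G\<^esub> id"
      by blast
    then obtain u where u: "u \<in> carrier G" "x = id \<circ> (u \<circ> inv\<^bsub>G\<^esub> id)"
      by (auto simp: l_coset_def r_coset_def point_stabilizer_def)
    moreover have "inv\<^bsub>G\<^esub> id = id"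
      using inv_G_apply[OF one] by (simp add: fun_eq_iff)
    ultimately have x_perm: "x permutes \<Omega>"
      by (simp add: G_permutes)
    have "x \<beta> = \<beta>" if \<beta>: "\<beta> \<in> \<Omega>" for \<beta>
    proof -
      obtain g where g: "g \<in> carrier G" "g \<alpha> = \<beta>"
        using transitive assms \<beta> by blast
      from x g(1) have "x \<in> (inv\<^bsub>G\<^esub> g) <#\<^bsub>G\<^esub> point_stabilizer G \<alpha> #>\<^bsub>G\<^esub> g"
        by blast
      then obtain u where "u \<in> point_stabilizer G \<alpha>" "x = g \<circ> (u \<circ> inv\<^bsub>G\<^esub> g)"
        by (auto simp: l_coset_def r_coset_def)
      moreover have "(inv\<^bsub>G\<^esub> g) \<beta> = \<alpha>"
        using inv_G_apply[OF g(1), of \<alpha>] by (simp add: g(2))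
      ultimately show ?thesis
        by (simp add: point_stabilizer_def g(2))
    qed
    with permutes_not_in[OF x_perm] show ?thesis
      by (intro ext) (metis id_apply)
  qed
  moreover have "id \<in> (inv\<^bsub>G\<^esub> g) <#\<^bsub>G\<^esub> point_stabilizer G \<alpha> #>\<^bsub>G\<^esub> g" if "g \<in> carrier G" for g
  proof -
    interpret group G by (rule group_G)
    have "id \<in> point_stabilizer G \<alpha>"
      using one_closed by (auto simp: point_stabilizer_def)
    moreover have "id = g \<circ> (id \<circ> inv\<^bsub>G\<^esub> g)"
      using l_inv[OF that] by simp
    ultimately show ?thesis
      unfolding l_coset_def r_coset_def mult_G UN_iff singleton_iff by blast
  qed
  ultimately show ?thesis
    unfolding core_free_def one_G by (intro equalityI subsetI) auto
qed

lemma monodromy_data_point_stabilizer: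
  assumes "\<alpha> \<in> \<Omega>" and "right_transversal G (point_stabilizer G \<alpha>) S"
  shows "monodromy_data G (point_stabilizer G \<alpha>) \<rho> \<tau> S"
proof -
  have "generate G {\<rho>, \<tau>} = generate (Sym \<Omega>) {\<rho>, \<tau>}"
    using group.generate_consistent[OF group_Sym _ subgroup_G, of "{\<rho>, \<tau>}"]
    by (auto simp: G_generated generate.incl)
  then have gen: "carrier G = generate G {\<rho>, \<tau>}"
    by (simp add: G_generated)
  then have "\<rho> \<in> carrier G" "\<tau> \<in> carrier G"
    by (auto intro: generate.incl)
  with gen show ?thesis
    using assms tau_square core_free_point_stabilizer subgroup_point_stabilizer
    by (auto intro!: monodromy_data.intro monodromy_data_axioms.intro group_G)
qed

end

end

theory Submission
  imports Defs
begin

text \<open>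
  An element \<open>g\<close> of \<open>G\<close> is sent to the dart \<open>g \<alpha>\<close>. By transitivity this identifies the right
  cosets of the stabilizer with the darts, hence the transversal \<open>S\<close> with \<open>\<Omega>\<close>, and right
  multiplication by \<open>\<tau>\<close> with the action of \<open>\<tau>\<close>. The double coset \<open>U g H\<close> is the preimage of the
  \<open>\<rho>\<close>-cycle through \<open>g \<alpha>\<close>, so the vertices correspond. As parallel edges of the monodromy graph
  are anonymous, it remains to see that every multiset of ends belongs to equally many edges in
  both graphs, which is a count of darts: a loop consists of two darts that both lie in \<open>D\<close>,
  while a free edge or a link has exactly one dart in \<open>D\<close>.
\<close>

section \<open>Indexed fibres and multisets of ends\<close>

text \<open>Each fibre of \<open>f\<close> is finite, so it can be numbered from 0; the number
  separates elements with equal \<open>f\<close>-value. With the ends as \<open>f\<close>, this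
  turns actual edges into the indexed edges of \<open>Mon\<close>.\<close>

lemma ex_bij_betw_multiplicity:
  assumes "finite E"
  shows "\<exists>\<psi>. bij_betw \<psi> E {(f e, i) |e i. e \<in> E \<and> i < card {e' \<in> E. f e' = f e}} \<and>
    (\<forall>e \<in> E. fst (\<psi> e) = f e)"
proof -
  have "\<exists>k. bij_betw k {e \<in> E. f e = x} {..<card {e \<in> E. f e = x}}" for x
    using ex_bij_betw_finite_nat[of "{e \<in> E. f e = x}"] assms by (simp add: lessThan_atLeast0)
  then obtain k where k: "\<And>x. bij_betw (k x) {e \<in> E. f e = x} {..<card {e \<in> E. f e = x}}"
    by metis
  define \<psi> where "\<psi> e = (f e, k (f e) e)" for e
  have "inj_on \<psi> E"
  proof (rule inj_onI)
    fix e e' assume "e \<in> E" "e' \<in> E" "\<psi> e = \<psi> e'"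
    then show "e = e'"
      using bij_betw_imp_inj_on[OF k, of "f e"] by (auto simp: \<psi>_def dest: inj_onD)
  qed
  moreover have "\<psi> ` E = {(f e, i) |e i. e \<in> E \<and> i < card {e' \<in> E. f e' = f e}}" (is "_ = ?R")
  proof
    show "\<psi> ` E \<subseteq> ?R"
      using bij_betw_apply[OF k] by (fastforce simp: \<psi>_def)
    show "?R \<subseteq> \<psi> ` E"
    proof clarify
      fix e i assume "e \<in> E" and i: "i < card {e' \<in> E. f e' = f e}"
      from i have "i \<in> k (f e) ` {e' \<in> E. f e' = f e}"
        unfolding bij_betw_imp_surj_on[OF k] by simp
      then obtain e' where "e' \<in> E" "f e' = f e" "k (f e) e' = i"
        by blast
      then show "(f e, i) \<in> \<psi> ` E"
        by (auto simp: \<psi>_def image_iff intro!: bexI[of _ e'])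
    qed
  qed
  ultimately show ?thesis
    by (intro exI[of _ \<psi>]) (auto simp: bij_betw_def \<psi>_def)
qed

text \<open>Mapping \<open>inv_into A f\<close> over the image recovers a multiset supported on
  \<open>A\<close>.\<close>

lemma image_mset_eq_iff_inj_on:
  assumes "inj_on f A" "set_mset M \<subseteq> A" "set_mset N \<subseteq> A"
  shows "image_mset f M = image_mset f N \<longleftrightarrow> M = N"
proof -
  have "image_mset (inv_into A f) (image_mset f K) = K" if "set_mset K \<subseteq> A" for K
  proof -
    have "image_mset (inv_into A f \<circ> f) K = image_mset id K"
      using that assms(1) by (intro image_mset_cong) auto
    then show ?thesis
      by (simp add: multiset.map_comp)
  qed
  with assms(2,3) show ?thesis
    by metis
qed

lemma mset_doubleton_eq_iff:
  "{#a, b#} = {#c, d#} \<longleftrightarrow> a = c \<and> b = d \<or> a = d \<and> b = c"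
  by (auto simp: add_eq_conv_diff)

text \<open>This is the vertex map of the isomorphism: on \<rho>-cycles its values are the double
  cosets.\<close>

definition dart_fibre :: "('a \<Rightarrow> 'a) monoid \<Rightarrow> 'a \<Rightarrow> 'a set \<Rightarrow> ('a \<Rightarrow> 'a) set" where
  "dart_fibre G \<alpha> c = {g \<in> carrier G. g \<alpha> \<in> c}"

section \<open>Cycles of the two generators\<close>

context algebraic_map
begin

abbreviation "\<Sigma> \<equiv> underlying_graph \<Omega> \<rho> \<tau>"

lemma generators_in_G: "\<rho> \<in> carrier G" "\<tau> \<in> carrier G"
  by (simp_all add: G_generated generate.incl)

lemma tau_tau [simp]: "\<tau> (\<tau> x) = x"
  using tau_square by (simp add: fun_eq_iff)

lemma tau_in_darts [simp]: "\<tau> x \<in> \<Omega> \<longleftrightarrow> x \<in> \<Omega>"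
  using permutes_in_image[OF tau_permutes] .

lemma orbit_tau: "orbit \<tau> \<beta> = {\<beta>, \<tau> \<beta>}"
proof
  show "orbit \<tau> \<beta> \<subseteq> {\<beta>, \<tau> \<beta>}"
  proof
    fix y assume "y \<in> orbit \<tau> \<beta>"
    then show "y \<in> {\<beta>, \<tau> \<beta>}" by induction auto
  qed
  show "{\<beta>, \<tau> \<beta>} \<subseteq> orbit \<tau> \<beta>"
    using orbit.step[OF orbit.base[of \<tau> \<beta>]] orbit.base[of \<tau> \<beta>] by simp
qed

text \<open>An \<open>orbit\<close> is built from forward images only, starting at the image of its
  point. Finiteness of \<Omega> makes \<rho> return to each point, so orbits are equivalence
  classes.\<close>

lemma in_orbit_rho_iff: "\<gamma> \<in> orbit \<rho> \<beta> \<longleftrightarrow> orbit \<rho> \<gamma> = orbit \<rho> \<beta>"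
proof -
  have "permutation \<rho>"
    using rho_permutes finite_darts by (auto simp: permutation_permutes)
  then show ?thesis
    using cyclic_on_orbit'[of \<rho> \<beta>] orbit_cyclic_eq3[of \<rho> "orbit \<rho> \<beta>" \<gamma>]
      permutation_self_in_orbit[of \<rho> \<gamma>] by blast
qed

lemma generate_rho_orbit: "{p \<beta> |p. p \<in> generate G {\<rho>}} = orbit \<rho> \<beta>"
proof
  have "p \<beta> \<in> orbit \<rho> \<beta>" if "p \<in> generate G {\<rho>}" for p
    using that
  proof (induction arbitrary: \<beta> rule: generate.induct)
    case one
    then show ?case by (simp add: in_orbit_rho_iff)
  next
    case (incl h)
    then show ?case by (simp add: orbit.base)
  next
    case (inv h)
    \<comment> \<open>An inverse is no forward iterate, but \<beta> is one step ahead of its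
      preimage, and sharing an orbit is symmetric.\<close>
    have "\<rho> ((inv\<^bsub>G\<^esub> \<rho>) \<beta>) = \<beta>"
      using group.l_inv[OF group_G generators_in_G(1)] by (simp add: fun_eq_iff)
    then have "\<beta> \<in> orbit \<rho> ((inv\<^bsub>G\<^esub> \<rho>) \<beta>)"
      using orbit.base[of \<rho>] by metis
    with inv show ?case by (simp add: in_orbit_rho_iff)
  next
    case (eng h1 h2)
    then show ?case by (metis comp_apply in_orbit_rho_iff mult_G)
  qed
  then show "{p \<beta> |p. p \<in> generate G {\<rho>}} \<subseteq> orbit \<rho> \<beta>"
    by blast
  show "orbit \<rho> \<beta> \<subseteq> {p \<beta> |p. p \<in> generate G {\<rho>}}"
  proof
    fix y assume "y \<in> orbit \<rho> \<beta>"
    then show "y \<in> {p \<beta> |p. p \<in> generate G {\<rho>}}"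
    proof induction
      case base
      show ?case by (blast intro: generate.incl)
    next
      case (step y)
      then obtain p where "p \<in> generate G {\<rho>}" "y = p \<beta>" by blast
      then show ?case
        using generate.eng[of p G "{\<rho>}" \<rho>] generate.incl[of \<rho> "{\<rho>}" G]
        by (auto intro!: exI[of _ "\<rho> \<circ> p"])
    qed
  qed
qed

section \<open>Cosets and double cosets in terms of darts\<close>

lemma r_coset_point_stabilizer:
  assumes h: "h \<in> carrier G"
  shows "point_stabilizer G \<alpha> #>\<^bsub>G\<^esub> h = {k \<in> carrier G. k \<alpha> = h \<alpha>}"
proof -
  interpret group G by (rule group_G)
  show ?thesis
  proof (intro equalityI subsetI)
    fix k assume "k \<in> point_stabilizer G \<alpha> #>\<^bsub>G\<^esub> h"
    then obtain u where "u \<in> carrier G" "u \<alpha> = \<alpha>" "k = u \<otimes>\<^bsub>G\<^esub> h"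
      by (auto simp: r_coset_def point_stabilizer_def)
    moreover from this have "k \<in> carrier G"
      using h by (metis m_closed)
    ultimately show "k \<in> {k \<in> carrier G. k \<alpha> = h \<alpha>}"
      by simp
  next
    fix k assume k: "k \<in> {k \<in> carrier G. k \<alpha> = h \<alpha>}"
    define u where "u = k \<otimes>\<^bsub>G\<^esub> inv\<^bsub>G\<^esub> h"
    \<comment> \<open>\<open>mult_G\<close> is removed from the simpset here and below: it would
      rewrite products to compositions, which the group laws no longer match.\<close>
    have "u \<in> carrier G"
      using h k unfolding u_def by (auto simp del: mult_G)
    moreover have "u \<alpha> = \<alpha>"
      using k inv_G_apply[OF h] by (simp add: u_def)
    moreover have "k = u \<otimes>\<^bsub>G\<^esub> h"
      using h k unfolding u_def by (simp add: m_assoc del: mult_G one_G)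
    ultimately show "k \<in> point_stabilizer G \<alpha> #>\<^bsub>G\<^esub> h"
      unfolding r_coset_def point_stabilizer_def by blast
  qed
qed

lemma mult_tau_in_r_coset_iff:
  assumes "h \<in> carrier G"
  shows "h \<otimes>\<^bsub>G\<^esub> \<tau> \<in> point_stabilizer G \<alpha> #>\<^bsub>G\<^esub> h \<longleftrightarrow> \<tau> (h \<alpha>) = h \<alpha>"
  using assms generators_in_G(2)
    monoid.m_closed[OF group.is_monoid[OF group_G], of h \<tau>]
  by (simp add: r_coset_point_stabilizer)

text \<open>Elements of the right coset of \<open>h\<close> send \<alpha> to
  \<open>h \<alpha>\<close>; a following element of the group generated by \<rho> can move this dart
  anywhere in its \<rho>-cycle.\<close>

lemma dcoset_point_stabilizer:
  assumes h: "h \<in> carrier G"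
  shows "dcoset G (point_stabilizer G \<alpha>) \<rho> h = dart_fibre G \<alpha> (orbit \<rho> (h \<alpha>))"
proof -
  interpret group G by (rule group_G)
  have gen: "p \<in> carrier G" if "p \<in> generate G {\<rho>}" for p
    using generate_in_carrier[OF _ that] generators_in_G by simp
  show ?thesis
  proof (intro equalityI subsetI)
    fix k assume "k \<in> dcoset G (point_stabilizer G \<alpha>) \<rho> h"
    then obtain x p where xp: "x \<in> carrier G" "x \<alpha> = h \<alpha>" "p \<in> generate G {\<rho>}" "k = x \<otimes>\<^bsub>G\<^esub> p"
      unfolding dcoset_def set_mult_def r_coset_point_stabilizer[OF h] by blast
    then have "k \<in> carrier G"
      using gen by (metis m_closed)
    with xp show "k \<in> dart_fibre G \<alpha> (orbit \<rho> (h \<alpha>))"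
      using generate_rho_orbit[of "h \<alpha>"] by (auto simp: dart_fibre_def)
  next
    fix k assume "k \<in> dart_fibre G \<alpha> (orbit \<rho> (h \<alpha>))"
    then obtain p where k: "k \<in> carrier G" and p: "p \<in> generate G {\<rho>}" "k \<alpha> = p (h \<alpha>)"
      using generate_rho_orbit[of "h \<alpha>"] by (auto simp: dart_fibre_def)
    \<comment> \<open>Applying \<open>k\<close> and then undoing \<open>p\<close> brings \<alpha>
      back to \<open>h \<alpha>\<close>.\<close>
    define x where "x = k \<otimes>\<^bsub>G\<^esub> inv\<^bsub>G\<^esub> p"
    have "x \<in> carrier G"
      using gen[OF p(1)] k unfolding x_def by (auto simp del: mult_G)
    moreover have "x \<alpha> = h \<alpha>"
      using p inv_G_apply[OF gen[OF p(1)]] by (simp add: x_def)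
    moreover have "k = x \<otimes>\<^bsub>G\<^esub> p"
      using gen[OF p(1)] k unfolding x_def by (simp add: m_assoc del: mult_G one_G)
    ultimately show "k \<in> dcoset G (point_stabilizer G \<alpha>) \<rho> h"
      using p(1) unfolding dcoset_def set_mult_def r_coset_point_stabilizer[OF h] by blast
  qed
qed

section \<open>Counting edges with given ends by darts\<close>

lemma edges_underlying: "edges \<Sigma> = orbit \<tau> ` \<Omega>"
  by (simp add: underlying_graph_def)

lemma ends_underlying_orbit:
  "ends \<Sigma> (orbit \<tau> \<beta>) =
    (if \<tau> \<beta> = \<beta> then {#orbit \<rho> \<beta>#} else {#orbit \<rho> \<beta>, orbit \<rho> (\<tau> \<beta>)#})"
  by (auto simp: underlying_graph_def orbit_tau)

text \<open>A single end forces the \<tau>-cycle to be one fixed dart, so edges and darts correspond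
  one to one.\<close>

lemma card_free_edges:
  assumes "\<tau> \<beta> = \<beta>"
  shows "card {e \<in> edges \<Sigma>. ends \<Sigma> e = ends \<Sigma> (orbit \<tau> \<beta>)} =
    card {\<gamma> \<in> \<Omega>. orbit \<rho> \<gamma> = orbit \<rho> \<beta> \<and> \<tau> \<gamma> = \<gamma>}" (is "card ?E = card ?D")
proof -
  have "?E = orbit \<tau> ` ?D"
    using assms by (auto simp: edges_underlying ends_underlying_orbit mset_doubleton_eq_iff
        split: if_splits)
  moreover have "inj_on (orbit \<tau>) ?D"
    by (auto simp: inj_on_def orbit_tau)
  ultimately show ?thesis
    by (simp add: card_image)
qed

text \<open>Both darts of a loop satisfy the condition on the right, so the loops partition these
  darts into pairs. This accounts for the division by two in \<open>mon_mult\<close>.\<close>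

lemma card_loops:
  assumes "\<tau> \<beta> \<noteq> \<beta>" "orbit \<rho> (\<tau> \<beta>) = orbit \<rho> \<beta>"
  shows "2 * card {e \<in> edges \<Sigma>. ends \<Sigma> e = ends \<Sigma> (orbit \<tau> \<beta>)} =
    card {\<gamma> \<in> \<Omega>. orbit \<rho> \<gamma> = orbit \<rho> \<beta> \<and> orbit \<rho> (\<tau> \<gamma>) = orbit \<rho> \<beta> \<and> \<tau> \<gamma> \<noteq> \<gamma>}"
    (is "2 * card ?E = card ?D")
proof -
  have E: "?E = orbit \<tau> ` ?D"
    using assms by (auto simp: edges_underlying ends_underlying_orbit mset_doubleton_eq_iff
        split: if_splits)
  have U: "\<Union>?E = ?D"
    unfolding E by (auto simp: orbit_tau)
  have fin: "finite ?D"
    using finite_darts by simp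
  have "2 * card ?E = card (\<Union>?E)"
  proof (rule card_partition)
    show "finite ?E" "finite (\<Union>?E)"
      using fin unfolding U by (simp_all add: E)
    show "card c = 2" if "c \<in> ?E" for c
      using that unfolding E by (auto simp: orbit_tau card_2_iff)
    show "c1 \<inter> c2 = {}" if "c1 \<in> ?E" "c2 \<in> ?E" "c1 \<noteq> c2" for c1 c2
    proof (rule ccontr)
      assume "c1 \<inter> c2 \<noteq> {}"
      then obtain \<gamma> where \<gamma>: "\<gamma> \<in> c1" "\<gamma> \<in> c2"
        by blast
      \<comment> \<open>A \<tau>-cycle is determined by any of its darts, so cycles that meet
        coincide.\<close>
      have "c = {\<gamma>, \<tau> \<gamma>}" if c: "c \<in> ?E" and "\<gamma> \<in> c" for c
        using that by (auto simp: edges_underlying orbit_tau)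
      from this[OF that(1) \<gamma>(1)] this[OF that(2) \<gamma>(2)] that(3) show False
        by (simp only:)
    qed
  qed
  then show ?thesis
    by (simp only: U)
qed

text \<open>The two end vertices differ, so exactly one dart of each link lies at the vertex of
  \<beta>.\<close>

lemma card_links:
  assumes "orbit \<rho> (\<tau> \<beta>) \<noteq> orbit \<rho> \<beta>"
  shows "card {e \<in> edges \<Sigma>. ends \<Sigma> e = ends \<Sigma> (orbit \<tau> \<beta>)} =
    card {\<gamma> \<in> \<Omega>. orbit \<rho> \<gamma> = orbit \<rho> \<beta> \<and> orbit \<rho> (\<tau> \<gamma>) = orbit \<rho> (\<tau> \<beta>)}"
    (is "card ?E = card ?D")
proof -
  have "?E = orbit \<tau> ` ?D"
  proof (intro equalityI subsetI)
    fix e assume e: "e \<in> ?E"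
    then obtain \<gamma> where \<gamma>: "\<gamma> \<in> \<Omega>" "e = orbit \<tau> \<gamma>"
      by (auto simp: edges_underlying)
    \<comment> \<open>The chosen \<gamma> may lie at the far end; then \<tau> \<gamma> represents
      the same edge from the right end.\<close>
    have "e = orbit \<tau> (\<tau> \<gamma>)"
      using \<gamma> by (auto simp: orbit_tau)
    moreover have "\<gamma> \<in> ?D \<or> \<tau> \<gamma> \<in> ?D"
      using e \<gamma> assms by (auto simp: ends_underlying_orbit mset_doubleton_eq_iff split: if_splits)
    ultimately show "e \<in> orbit \<tau> ` ?D"
      using \<gamma>(2) by blast
  next
    fix e assume "e \<in> orbit \<tau> ` ?D"
    then show "e \<in> ?E"
      using assms by (force simp: edges_underlying ends_underlying_orbit)
  qed
  \<comment> \<open>If both darts of one cycle were in \<open>?D\<close>, the two end vertices would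
    coincide.\<close>
  moreover have "inj_on (orbit \<tau>) ?D"
    using assms by (auto simp: inj_on_def orbit_tau doubleton_eq_iff)
  ultimately show ?thesis
    by (simp add: card_image)
qed

section \<open>Transfer to the monodromy graph\<close>

text \<open>A right coset of the stabilizer is determined by the image of \<alpha>, and
  \<open>S\<close> meets each coset once; transitivity gives surjectivity.\<close>

lemma bij_betw_transversal:
  assumes \<alpha>: "\<alpha> \<in> \<Omega>" and S: "right_transversal G (point_stabilizer G \<alpha>) S"
  shows "bij_betw (\<lambda>s. s \<alpha>) S \<Omega>"
proof -
  interpret group G by (rule group_G)
  have SG: "S \<subseteq> carrier G"
    using S by (simp add: right_transversal_def)
  have ex1: "\<exists>!s. s \<in> S \<and> s \<alpha> = h \<alpha>" if h: "h \<in> carrier G" for h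
  proof -
    have "point_stabilizer G \<alpha> #>\<^bsub>G\<^esub> h \<in> rcosets\<^bsub>G\<^esub> (point_stabilizer G \<alpha>)"
      using h by (auto simp: RCOSETS_def)
    with S have "\<exists>!s. s \<in> S \<inter> (point_stabilizer G \<alpha> #>\<^bsub>G\<^esub> h)"
      by (simp add: right_transversal_def)
    then show ?thesis
      using SG unfolding r_coset_point_stabilizer[OF h] by blast
  qed
  show ?thesis
  proof (rule bij_betwI')
    show "x \<alpha> = y \<alpha> \<longleftrightarrow> x = y" if "x \<in> S" "y \<in> S" for x y
      using ex1[of y] that SG by blast
    show "x \<alpha> \<in> \<Omega>" if "x \<in> S" for x
      using that SG \<alpha> permutes_in_image[OF G_permutes, of x \<alpha>] by blast
    show "\<exists>x\<in>S. \<beta> = x \<alpha>" if \<beta>: "\<beta> \<in> \<Omega>" for \<beta>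
    proof -
      obtain g where "g \<in> carrier G" "g \<alpha> = \<beta>"
        using transitive \<alpha> \<beta> by blast
      with ex1[of g] show ?thesis by metis
    qed
  qed
qed

lemma mon_ends_point_stabilizer:
  assumes h: "h \<in> carrier G"
  shows "mon_ends G (point_stabilizer G \<alpha>) \<rho> \<tau> h =
    image_mset (dart_fibre G \<alpha>) (ends \<Sigma> (orbit \<tau> (h \<alpha>)))"
  unfolding mon_ends_def mult_tau_in_r_coset_iff[OF h]
  using h monoid.m_closed[OF group.is_monoid[OF group_G] h generators_in_G(2)]
  by (simp add: ends_underlying_orbit dcoset_point_stabilizer)

text \<open>Evaluation at \<alpha> turns \<open>mon_D\<close> into a set of darts, and the three
  branches of \<open>mon_mult\<close> become the three counts above.\<close>

lemma mon_mult_point_stabilizer: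
  assumes \<alpha>: "\<alpha> \<in> \<Omega>" and S: "right_transversal G (point_stabilizer G \<alpha>) S" and h: "h \<in> S"
  shows "mon_mult G (point_stabilizer G \<alpha>) \<rho> \<tau> S h =
    card {e \<in> edges \<Sigma>. ends \<Sigma> e = ends \<Sigma> (orbit \<tau> (h \<alpha>))}"
proof -
  interpret group G by (rule group_G)
  have SG: "g \<in> carrier G" "g \<otimes>\<^bsub>G\<^esub> \<tau> \<in> carrier G" if "g \<in> S" for g
    using that S m_closed[OF _ generators_in_G(2), of g] by (auto simp: right_transversal_def)
  have D: "mon_D G (point_stabilizer G \<alpha>) \<rho> \<tau> S h =
      {g \<in> S. orbit \<rho> (g \<alpha>) = orbit \<rho> (h \<alpha>) \<and> orbit \<rho> (\<tau> (g \<alpha>)) = orbit \<rho> (\<tau> (h \<alpha>))}"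
    unfolding mon_D_def dcoset_point_stabilizer[OF SG(1)[OF h]]
      dcoset_point_stabilizer[OF SG(2)[OF h]]
    using SG by (auto simp: dart_fibre_def in_orbit_rho_iff)
  have loop: "h \<otimes>\<^bsub>G\<^esub> \<tau> \<in> dcoset G (point_stabilizer G \<alpha>) \<rho> h \<longleftrightarrow>
      orbit \<rho> (\<tau> (h \<alpha>)) = orbit \<rho> (h \<alpha>)"
    unfolding dcoset_point_stabilizer[OF SG(1)[OF h]]
    using SG[OF h] by (simp add: dart_fibre_def in_orbit_rho_iff)
  have count: "card {g \<in> S. P (g \<alpha>)} = card {\<gamma> \<in> \<Omega>. P \<gamma>}" for P
    using bij_betw_Collect[OF bij_betw_transversal[OF \<alpha> S], of P "\<lambda>g. P (g \<alpha>)"]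
    by (auto intro: bij_betw_same_card)
  have free: "g \<otimes>\<^bsub>G\<^esub> \<tau> \<in> point_stabilizer G \<alpha> #>\<^bsub>G\<^esub> g \<longleftrightarrow> \<tau> (g \<alpha>) = g \<alpha>" if "g \<in> S" for g
    using mult_tau_in_r_coset_iff SG(1)[OF that] .
  let ?o = "orbit \<rho>" and ?\<beta> = "h \<alpha>"
  let ?D = "mon_D G (point_stabilizer G \<alpha>) \<rho> \<tau> S h"
  consider "\<tau> ?\<beta> = ?\<beta>" | "\<tau> ?\<beta> \<noteq> ?\<beta>" "?o (\<tau> ?\<beta>) = ?o ?\<beta>" | "?o (\<tau> ?\<beta>) \<noteq> ?o ?\<beta>"
    by blast
  then show ?thesis
  proof cases
    case 1
    \<comment> \<open>When \<open>g \<alpha>\<close> and \<open>?\<beta>\<close> are both fixed by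
      \<tau>, the second orbit condition in \<open>D\<close> repeats the first.\<close>
    have "{g \<in> ?D. g \<otimes>\<^bsub>G\<^esub> \<tau> \<in> point_stabilizer G \<alpha> #>\<^bsub>G\<^esub> g} =
        {g \<in> S. ?o (g \<alpha>) = ?o ?\<beta> \<and> \<tau> (g \<alpha>) = g \<alpha>}"
      unfolding D using 1 free by auto
    then show ?thesis
      using 1 card_free_edges[OF 1] free[OF h]
        count[of "\<lambda>\<gamma>. ?o \<gamma> = ?o ?\<beta> \<and> \<tau> \<gamma> = \<gamma>"]
      by (simp add: mon_mult_def del: mult_G)
  next
    case 2
    have "{g \<in> ?D. g \<otimes>\<^bsub>G\<^esub> \<tau> \<notin> point_stabilizer G \<alpha> #>\<^bsub>G\<^esub> g} =
        {g \<in> S. ?o (g \<alpha>) = ?o ?\<beta> \<and> ?o (\<tau> (g \<alpha>)) = ?o ?\<beta> \<and> \<tau> (g \<alpha>) \<noteq> g \<alpha>}"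
      unfolding D using 2 free by auto
    then show ?thesis
      using 2 card_loops[OF 2] free[OF h] loop
        count[of "\<lambda>\<gamma>. ?o \<gamma> = ?o ?\<beta> \<and> ?o (\<tau> \<gamma>) = ?o ?\<beta> \<and> \<tau> \<gamma> \<noteq> \<gamma>"]
      by (simp add: mon_mult_def del: mult_G)
  next
    case 3
    then have "\<tau> ?\<beta> \<noteq> ?\<beta>"
      by auto
    then show ?thesis
      using 3 card_links[OF 3] free[OF h] loop D
        count[of "\<lambda>\<gamma>. ?o \<gamma> = ?o ?\<beta> \<and> ?o (\<tau> \<gamma>) = ?o (\<tau> ?\<beta>)"]
      by (simp add: mon_mult_def del: mult_G)
  qed
qed

text \<open>By transitivity every dart is some \<open>g \<alpha>\<close>, so a set of darts is
  determined by its preimage in the group, and every \<rho>-cycle has a double coset as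
  preimage.\<close>

lemma bij_betw_dart_fibre:
  assumes \<alpha>: "\<alpha> \<in> \<Omega>"
  shows "bij_betw (dart_fibre G \<alpha>) (verts \<Sigma>) (verts (Mon G (point_stabilizer G \<alpha>) \<rho> \<tau> S))"
proof -
  have V: "verts \<Sigma> = orbit \<rho> ` \<Omega>"
    by (simp add: underlying_graph_def)
  have darts: "\<Omega> = (\<lambda>g. g \<alpha>) ` carrier G"
  proof (intro equalityI subsetI)
    fix \<beta> assume "\<beta> \<in> \<Omega>"
    then show "\<beta> \<in> (\<lambda>g. g \<alpha>) ` carrier G"
      using transitive \<alpha> by fast
  next
    fix \<beta> assume "\<beta> \<in> (\<lambda>g. g \<alpha>) ` carrier G"
    then show "\<beta> \<in> \<Omega>"
      using \<alpha> permutes_in_image[OF G_permutes, of _ \<alpha>] by blast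
  qed
  have "inj_on (dart_fibre G \<alpha>) (verts \<Sigma>)"
  proof (rule inj_onI)
    fix c d assume "c \<in> verts \<Sigma>" "d \<in> verts \<Sigma>" and eq: "dart_fibre G \<alpha> c = dart_fibre G \<alpha> d"
    then have "c \<subseteq> \<Omega>" "d \<subseteq> \<Omega>"
      using permutes_orbit_subset[OF rho_permutes] unfolding V by blast+
    moreover have "g \<alpha> \<in> c \<longleftrightarrow> g \<alpha> \<in> d" if "g \<in> carrier G" for g
      using eq that by (auto simp: dart_fibre_def set_eq_iff)
    ultimately show "c = d"
      unfolding darts by blast
  qed
  moreover have "dart_fibre G \<alpha> ` verts \<Sigma> = verts (Mon G (point_stabilizer G \<alpha>) \<rho> \<tau> S)"
    unfolding V by (subst darts) (simp add: Mon_def image_image dcoset_point_stabilizer)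
  ultimately show ?thesis
    by (simp add: bij_betw_def)
qed

text \<open>This puts the edges of \<open>Mon\<close> into the shape produced by
  \<open>ex_bij_betw_multiplicity\<close>.\<close>

lemma edges_Mon_point_stabilizer:
  assumes \<alpha>: "\<alpha> \<in> \<Omega>" and S: "right_transversal G (point_stabilizer G \<alpha>) S"
  defines "f \<equiv> \<lambda>e. image_mset (dart_fibre G \<alpha>) (ends \<Sigma> e)"
  shows "edges (Mon G (point_stabilizer G \<alpha>) \<rho> \<tau> S) =
    {(f e, i) |e i. e \<in> edges \<Sigma> \<and> i < card {e' \<in> edges \<Sigma>. f e' = f e}}"
proof -
  have E: "edges \<Sigma> = (\<lambda>s. orbit \<tau> (s \<alpha>)) ` S"
    using bij_betw_imp_surj_on[OF bij_betw_transversal[OF \<alpha> S]]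
    by (auto simp: edges_underlying)
  \<comment> \<open>The vertex map is injective, so passing to double cosets merges no two multisets
    of ends and keeps all multiplicities.\<close>
  have "f e' = f e \<longleftrightarrow> ends \<Sigma> e' = ends \<Sigma> e" if "e \<in> edges \<Sigma>" "e' \<in> edges \<Sigma>" for e e'
    unfolding f_def using that wf_underlying_graph
    by (intro image_mset_eq_iff_inj_on[OF bij_betw_imp_inj_on[OF bij_betw_dart_fibre[OF \<alpha>]]])
      (auto simp: wf_graph_def)
  then have "{e' \<in> edges \<Sigma>. f e' = f e} = {e' \<in> edges \<Sigma>. ends \<Sigma> e' = ends \<Sigma> e}"
    if "e \<in> edges \<Sigma>" for e
    using that by blast
  then have mult: "mon_mult G (point_stabilizer G \<alpha>) \<rho> \<tau> S s =
      card {e' \<in> edges \<Sigma>. f e' = f (orbit \<tau> (s \<alpha>))}" if "s \<in> S" for s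
    using that mon_mult_point_stabilizer[OF \<alpha> S that] by (simp add: E)
  have ends: "mon_ends G (point_stabilizer G \<alpha>) \<rho> \<tau> s = f (orbit \<tau> (s \<alpha>))" if "s \<in> S" for s
    using S that by (auto simp: f_def mon_ends_point_stabilizer right_transversal_def)
  have "edges (Mon G (point_stabilizer G \<alpha>) \<rho> \<tau> S) =
      {(f (orbit \<tau> (s \<alpha>)), i) |s i. s \<in> S \<and> i < card {e' \<in> edges \<Sigma>. f e' = f (orbit \<tau> (s \<alpha>))}}"
    unfolding Mon_def graph.simps
    by (intro Collect_cong ex_cong1) (auto simp: mult ends)
  also have "\<dots> = {(f e, i) |e i. e \<in> edges \<Sigma> \<and> i < card {e' \<in> edges \<Sigma>. f e' = f e}}"
  proof -
    \<comment> \<open>Several \<open>s\<close> may give one edge; the bound depends only on the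
      \<open>f\<close>-value, so they contribute the same pairs.\<close>
    have "{(f (h s), i) |s i. s \<in> S \<and> i < m (f (h s))} =
        {(f e, i) |e i. e \<in> h ` S \<and> i < m (f e)}" for h and m :: "_ \<Rightarrow> nat"
      by blast
    from this[of "\<lambda>s. orbit \<tau> (s \<alpha>)" "\<lambda>x. card {e' \<in> edges \<Sigma>. f e' = x}"] show ?thesis
      by (simp only: E[symmetric])
  qed
  finally show ?thesis .
qed

end

theorem theorem3p7:
  fixes G :: "('a \<Rightarrow> 'a) monoid" and \<Omega> :: "'a set" and \<rho> \<tau> :: "'a \<Rightarrow> 'a" and \<alpha> :: 'a
    and S :: "('a \<Rightarrow> 'a) set"
  assumes "algebraic_map G \<Omega> \<rho> \<tau>"
    and "\<alpha> \<in> \<Omega>"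
    and "right_transversal G (point_stabilizer G \<alpha>) S"
  shows "graph_isomorphic (underlying_graph \<Omega> \<rho> \<tau>) (Mon G (point_stabilizer G \<alpha>) \<rho> \<tau> S)"
proof -
  interpret algebraic_map G \<Omega> \<rho> \<tau>
    by fact
  have "finite (edges \<Sigma>)"
    using finite_darts by (simp add: edges_underlying)
  from ex_bij_betw_multiplicity[OF this, of "\<lambda>e. image_mset (dart_fibre G \<alpha>) (ends \<Sigma> e)"]
  obtain \<psi> where "bij_betw \<psi> (edges \<Sigma>) (edges (Mon G (point_stabilizer G \<alpha>) \<rho> \<tau> S))"
    and "\<forall>e \<in> edges \<Sigma>. fst (\<psi> e) = image_mset (dart_fibre G \<alpha>) (ends \<Sigma> e)"
    unfolding edges_Mon_point_stabilizer[OF assms(2,3)] by blast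
  \<comment> \<open>The first component of \<open>\<psi> e\<close> is the image of the ends of
    \<open>e\<close>, so compatibility with ends is immediate.\<close>
  moreover have "ends (Mon G (point_stabilizer G \<alpha>) \<rho> \<tau> S) = fst"
    by (simp add: Mon_def)
  ultimately show ?thesis
    unfolding graph_isomorphic_def using bij_betw_dart_fibre[OF assms(2)]
    by (intro exI[of _ "dart_fibre G \<alpha>"] exI[of _ \<psi>]) simp
qed

end
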